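(* Let $G$ be a finite simple graph with vertex set $V=\{x_1,\ldots,x_n\}$ and without isolated vertices. Let $0\neq a=(a_i)\in\mathbb{N}^n$, let $b\in\mathbb{N}$, and let $\Upsilon(G)$ be the family of minimal vertex covers of $G$. (i) If $G$ is bipartite, then $a$ is an irreducible $b$-cover of $G$ if and only if $b=0$ and $a=e_i$ for some $1\leq i\leq n$, or $b=1$ and $a=\sum_{x_i\in C}e_i$ for some $C\in\Upsilon(G)$. (ii) If $G$ is non-bipartite, then $a$ is an irreducible $b$-cover of $G$ if and only if $a$ has one of the following forms: (a) $b=0$ and $a=e_i$ for some $1\leq i\leq n$; (b) $b=1$ and $a=\sum_{x_i\in C}e_i$ for some $C\in\Upsilon(G)$; (c) $b=2$ and $a=(1,\ldots,1)$; (d) $b=2$ and, up to permutation of the vertices, $$a=(\underbrace{0,\ldots,0}_{|A|},\underbrace{2,\ldots,2}_{|N_G(A)|},1,\ldots,1)$$ for some independent set of vertices $A\neq\emptyset$ of $G$ (that is, $a_i=0$ if $x_i\in A$, $a_i=2$ if $x_i\in N_G(A)$, and $a_i=1$ otherwise) such that (d$_1$) $N_G(A)$ is not a vertex cover of $G$ and $V\neq A\cup N_G(A)$, and (d$_2$) the induced subgraph $\langle V\setminus(A\cup N_G(A))\rangle$ has no isolated vertices and is not bipartite.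
   Context: $\mathbb{N}=\{0,1,2,\ldots\}$; $e_i$ is the $i$th unit vector of $\mathbb{R}^n$. A nonzero vector $a=(a_1,\ldots,a_n)\in\mathbb{N}^n$ is a $b$-cover of $G$ ($b\in\mathbb{N}$) if $a_i+a_j\geq b$ for every edge $\{x_i,x_j\}$ of $G$. A $b$-cover $a$ is reducible if there exist an $i$-cover $c$ and a $j$-cover $d$ of $G$ ($c,d$ nonzero vectors in $\mathbb{N}^n$, $i,j\in\mathbb{N}$) such that $a=c+d$ and $b=i+j$; otherwise it is irreducible. A vertex cover is a set of vertices meeting every edge; it is minimal if no proper subset is a vertex cover. $N_G(A)$ is the set of vertices adjacent to at least one vertex of $A$. A set of vertices is independent if no two of its vertices are adjacent. $\langle S\rangle$ is the subgraph of $G$ induced by $S$. *)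

theory Defs
  imports "HOL-Analysis.Finite_Cartesian_Product"
begin

record 'v ugraph =
  verts :: "'v set"
  edges :: "'v set set"

definition finite_simple_graph :: "'v ugraph \<Rightarrow> bool" where
  "finite_simple_graph G \<longleftrightarrow>
     finite (verts G) \<and> (\<forall>e\<in>edges G. e \<subseteq> verts G \<and> card e = 2)"

definition no_isolated_vertices :: "'v ugraph \<Rightarrow> bool" where
  "no_isolated_vertices G \<longleftrightarrow> (\<forall>v\<in>verts G. \<exists>u. {u, v} \<in> edges G)"

text \<open>The two parts may be empty; in particular, an edgeless graph is bipartite.\<close>

definition bipartite :: "'v ugraph \<Rightarrow> bool" where
  "bipartite G \<longleftrightarrow>
     (\<exists>X Y. X \<union> Y = verts G \<and> X \<inter> Y = {} \<and>
            (\<forall>e\<in>edges G. \<exists>x\<in>X. \<exists>y\<in>Y. e = {x, y}))"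

definition induced_subgraph :: "'v ugraph \<Rightarrow> 'v set \<Rightarrow> 'v ugraph" where
  "induced_subgraph G S =
     \<lparr>verts = verts G \<inter> S, edges = {e \<in> edges G. e \<subseteq> S}\<rparr>"

definition independent_set :: "'v ugraph \<Rightarrow> 'v set \<Rightarrow> bool" where
  "independent_set G A \<longleftrightarrow>
     A \<subseteq> verts G \<and> (\<forall>u\<in>A. \<forall>v\<in>A. {u, v} \<notin> edges G)"

definition neighbour_set :: "'v ugraph \<Rightarrow> 'v set \<Rightarrow> 'v set" where
  "neighbour_set G A = {v \<in> verts G. \<exists>u\<in>A. {u, v} \<in> edges G}"

definition vertex_cover :: "'v ugraph \<Rightarrow> 'v set \<Rightarrow> bool" where
  "vertex_cover G C \<longleftrightarrow> C \<subseteq> verts G \<and> (\<forall>e\<in>edges G. e \<inter> C \<noteq> {})"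

definition minimal_vertex_covers :: "'v ugraph \<Rightarrow> 'v set set" where
  "minimal_vertex_covers G =
     {C. vertex_cover G C \<and> (\<forall>D. D \<subset> C \<longrightarrow> \<not> vertex_cover G D)}"

text \<open>
  Vectors are indexed by a whole finite type, so the following three notions are meant for
  graphs whose vertex set is that type, i.e. with \<open>verts G = UNIV\<close>.
\<close>

definition b_cover :: "'v::finite ugraph \<Rightarrow> nat \<Rightarrow> nat ^ 'v \<Rightarrow> bool" where
  "b_cover G b a \<longleftrightarrow>
     a \<noteq> 0 \<and> (\<forall>i j. {i, j} \<in> edges G \<longrightarrow> a $ i + a $ j \<ge> b)"

definition reducible_cover :: "'v::finite ugraph \<Rightarrow> nat \<Rightarrow> nat ^ 'v \<Rightarrow> bool" where
  "reducible_cover G b a \<longleftrightarrow>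
     b_cover G b a \<and>
     (\<exists>i j c d. b_cover G i c \<and> b_cover G j d \<and> a = c + d \<and> b = i + j)"

definition irreducible_cover :: "'v::finite ugraph \<Rightarrow> nat \<Rightarrow> nat ^ 'v \<Rightarrow> bool" where
  "irreducible_cover G b a \<longleftrightarrow> b_cover G b a \<and> \<not> reducible_cover G b a"

end

theory Submission
  imports Defs
begin

text \<open>
  Every \<open>b\<close>-cover \<open>a\<close> with \<open>b \<ge> 2\<close> splits off the 2-cover with entry \<open>0\<close> where \<open>a\<close> vanishes, \<open>2\<close>
  where \<open>a \<ge> b\<close> and \<open>1\<close> elsewhere, leaving a \<open>(b - 2)\<close>-cover. Hence an irreducible cover has
  \<open>b \<le> 2\<close>, and for \<open>b = 2\<close> it has entries in \<open>{0, 1, 2}\<close>. In that case it is determined by its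
  zero set \<open>A\<close>, and it splits into two 1-covers exactly when the graph induced on
  \<open>R = V - (A \<union> N(A))\<close> is bipartite: add the indicator of \<open>N(A)\<close> to those of the two colour
  classes. Taking \<open>A = {}\<close> gives form (c), and condition (d1) follows from \<open>R\<close> being
  non-bipartite.
\<close>

section \<open>Sums of unit vectors and bipartite graphs\<close>

lemma sum_axis_one:
  "(\<Sum>i\<in>C. axis i 1) = (\<chi> i. if i \<in> C then 1 else (0 :: nat) :: nat ^ 'v::finite)"
  by (simp add: vec_eq_iff axis_def sum.delta)

lemma bipartiteE:
  assumes "bipartite G"
  obtains X Y where "X \<union> Y = verts G" "X \<inter> Y = {}"
    "\<forall>e\<in>edges G. \<exists>x\<in>X. \<exists>y\<in>Y. e = {x, y}"
  using assms unfolding bipartite_def by (elim exE conjE) (rule that)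

lemma bipartite_induced_subgraph:
  assumes "bipartite G"
  shows "bipartite (induced_subgraph G S)"
proof -
  obtain X Y where XY: "X \<union> Y = verts G" "X \<inter> Y = {}"
    "\<forall>e\<in>edges G. \<exists>x\<in>X. \<exists>y\<in>Y. e = {x, y}"
    using assms by (rule bipartiteE)
  have "\<exists>x\<in>X \<inter> S. \<exists>y\<in>Y \<inter> S. e = {x, y}" if e: "e \<in> edges G" "e \<subseteq> S" for e
  proof -
    obtain x y where "x \<in> X" "y \<in> Y" "e = {x, y}" using XY(3) e(1) by metis
    then show ?thesis using e(2) by (intro bexI[of _ x] bexI[of _ y]) auto
  qed
  then have "\<forall>e\<in>edges (induced_subgraph G S). \<exists>x\<in>X \<inter> S. \<exists>y\<in>Y \<inter> S. e = {x, y}"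
    by (simp add: induced_subgraph_def)
  moreover have "(X \<inter> S) \<union> (Y \<inter> S) = verts (induced_subgraph G S)" "(X \<inter> S) \<inter> (Y \<inter> S) = {}"
    using XY(1,2) by (auto simp: induced_subgraph_def)
  ultimately show ?thesis
    unfolding bipartite_def by blast
qed

text \<open>Used in contrapositive form: a non-bipartite graph has an edge.\<close>

lemma bipartite_edgeless:
  assumes "edges G = {}"
  shows "bipartite G"
  unfolding bipartite_def
  by (rule exI[of _ "verts G"], rule exI[of _ "{}"]) (simp add: assms)

section \<open>Covers and irreducibility in an arbitrary graph\<close>

lemma b_coverD: "b_cover G b a \<Longrightarrow> {i, j} \<in> edges G \<Longrightarrow> b \<le> a $ i + a $ j"
  by (simp add: b_cover_def)

text \<open>The bounds on \<open>c\<close> and \<open>d\<close> add up along each edge, and over the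
  naturals nothing cancels, so a sum with a nonzero summand is nonzero.\<close>

lemma reducible_coverI:
  assumes "b_cover G i c" "b_cover G j d" "a = c + d" "b = i + j"
  shows "reducible_cover G b a"
proof -
  have "a \<noteq> 0"
    using assms(1,3) by (auto simp: b_cover_def vec_eq_iff)
  moreover have "b \<le> a $ u + a $ v" if "{u, v} \<in> edges G" for u v
    using b_coverD[OF assms(1) that] b_coverD[OF assms(2) that] assms(3,4) by simp
  ultimately have "b_cover G b a" by (simp add: b_cover_def)
  then show ?thesis
    using assms unfolding reducible_cover_def by blast
qed

text \<open>Every nonzero vector is a 0-cover. So a nonzero difference \<open>a - d\<close> would
  give the reduction of \<open>a\<close> into a 0-cover and the \<open>b\<close>-cover
  \<open>d\<close>.\<close>

lemma irreducible_cover_minimal: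
  assumes "irreducible_cover G b a" "b_cover G b d" "\<And>i. d $ i \<le> a $ i"
  shows "d = a"
proof (rule ccontr)
  assume "d \<noteq> a"
  let ?c = "\<chi> i. a $ i - d $ i"
  have "?c \<noteq> 0"
  proof
    assume "?c = 0"
    then have "a $ i - d $ i = 0" for i by (simp add: vec_eq_iff)
    then have "d = a"
      using assms(3) by (simp add: vec_eq_iff le_antisym)
    with \<open>d \<noteq> a\<close> show False by simp
  qed
  then have "b_cover G 0 ?c" by (simp add: b_cover_def)
  then have "reducible_cover G b a"
    by (rule reducible_coverI[OF _ assms(2)]) (use assms(3) in \<open>simp_all add: vec_eq_iff\<close>)
  then show False using assms(1) by (simp add: irreducible_cover_def)
qed

text \<open>Decompositions are sorted by weight. If one weight is 0, the other summand is a
  \<open>b\<close>-cover, and the second premise makes the 0-cover vanish, which no cover may do.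
  Two positive weights are left to the third premise, which is vacuous for \<open>b\<close> equal to
  0 or 1.\<close>

lemma irreducible_coverI:
  assumes "b_cover G b a"
    and "\<And>c d. b_cover G b d \<Longrightarrow> a = c + d \<Longrightarrow> c = 0"
    and "\<And>i j c d. 0 < i \<Longrightarrow> 0 < j \<Longrightarrow> b = i + j \<Longrightarrow> b_cover G i c \<Longrightarrow> b_cover G j d \<Longrightarrow> a \<noteq> c + d"
  shows "irreducible_cover G b a"
  unfolding irreducible_cover_def reducible_cover_def
proof (intro conjI notI assms(1), elim conjE exE)
  fix i j c d
  assume cd: "b_cover G i c" "b_cover G j d" "a = c + d" "b = i + j"
  have "c \<noteq> 0" "d \<noteq> 0" using cd by (auto simp: b_cover_def)
  show False
  proof (cases "i = 0 \<or> j = 0")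
    case True
    then show False
      using assms(2)[of d c] assms(2)[of c d] cd \<open>c \<noteq> 0\<close> \<open>d \<noteq> 0\<close> by (auto simp: add.commute)
  next
    case False
    then show False using assms(3) cd by blast
  qed
qed

section \<open>Graphs without isolated vertices\<close>

context
  fixes G :: "'v::finite ugraph"
  assumes simple: "finite_simple_graph G"
    and verts: "verts G = UNIV"
    and no_isolated: "no_isolated_vertices G"
begin

lemma not_loop: "{v, v} \<notin> edges G"
  using simple by (auto simp: finite_simple_graph_def)

lemma edgeE:
  assumes "e \<in> edges G"
  obtains u v where "e = {u, v}"
  using assms simple by (metis finite_simple_graph_def card_2_iff)

lemma has_neighbour:
  obtains u where "{u, v} \<in> edges G"
  using no_isolated verts by (auto simp: no_isolated_vertices_def)

text \<open>For positive \<open>b\<close> a cover cannot vanish: a type is nonempty, so there is a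
  vertex, it lies on an edge, and that edge forces a positive entry.\<close>

lemma b_coverI:
  assumes "0 < b" "\<And>i j. {i, j} \<in> edges G \<Longrightarrow> b \<le> a $ i + a $ j"
  shows "b_cover G b a"
proof -
  obtain u v where "{u, v} \<in> edges G" using has_neighbour by blast
  then have "0 < a $ u + a $ v" using assms by fastforce
  then have "a \<noteq> 0" by auto
  then show ?thesis using assms(2) by (simp add: b_cover_def)
qed

section \<open>Irreducible 0-covers\<close>

lemma irreducible_0_cover_iff:
  "irreducible_cover G 0 a \<longleftrightarrow> (\<exists>i. a = axis i 1)"
proof
  assume irr: "irreducible_cover G 0 a"
  then have "a \<noteq> 0" by (auto simp: irreducible_cover_def b_cover_def)
  then obtain i where "a $ i \<noteq> 0" by (auto simp: vec_eq_iff)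
  moreover have "b_cover G 0 (axis i 1)"
    by (auto simp: b_cover_def)
  \<comment> \<open>The unit vector at a nonzero coordinate of \<open>a\<close> lies below
    \<open>a\<close> and is itself a 0-cover, so minimality identifies the two.\<close>
  ultimately have "axis i 1 = a"
    by (intro irreducible_cover_minimal[OF irr]) (auto simp: axis_def)
  then show "\<exists>i. a = axis i 1" by blast
next
  assume "\<exists>i. a = axis i 1"
  then obtain i where i: "a = axis i 1" ..
  show "irreducible_cover G 0 a"
  proof (rule irreducible_coverI)
    show "b_cover G 0 a" by (auto simp: b_cover_def i)
    fix c d
    assume d: "b_cover G 0 d" and eq: "a = c + d"
    have sum: "c $ j + d $ j = (if j = i then 1 else 0)" for j
      using arg_cong[OF eq, of "\<lambda>x. x $ j"] by (auto simp: i axis_def)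
    \<comment> \<open>The nonzero \<open>d\<close> uses up the only unit of \<open>a\<close>,
      leaving nothing for \<open>c\<close>.\<close>
    obtain k where "d $ k \<noteq> 0" using d by (auto simp: b_cover_def vec_eq_iff)
    then have "k = i" using sum[of k] by (auto split: if_splits)
    then have "c $ j = 0" for j
      using sum[of j] \<open>d $ k \<noteq> 0\<close> by (auto split: if_splits)
    then show "c = 0" by (simp add: vec_eq_iff)
  qed simp
qed

section \<open>Irreducible 1-covers and minimal vertex covers\<close>

lemma b_cover_indicator:
  assumes "vertex_cover G C"
  shows "b_cover G 1 (\<chi> i. if i \<in> C then 1 else 0)"
proof (rule b_coverI)
  fix i j
  assume "{i, j} \<in> edges G"
  then have "{i, j} \<inter> C \<noteq> {}" using assms unfolding vertex_cover_def by blast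
  then show "1 \<le> ((\<chi> i. if i \<in> C then 1 else 0) :: nat ^ 'v) $ i
      + ((\<chi> i. if i \<in> C then 1 else 0) :: nat ^ 'v) $ j"
    by auto
qed simp

lemma vertex_cover_support:
  assumes "b_cover G 1 a"
  shows "vertex_cover G {i. a $ i \<noteq> 0}"
  unfolding vertex_cover_def
proof (intro conjI ballI)
  fix e
  assume "e \<in> edges G"
  then obtain u v where uv: "e = {u, v}" by (rule edgeE)
  then show "e \<inter> {i. a $ i \<noteq> 0} \<noteq> {}"
    using b_coverD[OF assms, of u v] \<open>e \<in> edges G\<close> by (cases "a $ u = 0") auto
qed (simp add: verts)

lemma irreducible_1_cover_iff:
  "irreducible_cover G 1 a \<longleftrightarrow> (\<exists>C\<in>minimal_vertex_covers G. a = (\<Sum>i\<in>C. axis i 1))"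
proof
  assume irr: "irreducible_cover G 1 a"
  let ?C = "{i. a $ i \<noteq> 0}"
  have C: "vertex_cover G ?C"
    using irr by (intro vertex_cover_support) (simp add: irreducible_cover_def)
  \<comment> \<open>Taking \<open>D = ?C\<close> shows that \<open>a\<close> is 0-1-valued; a
    smaller \<open>D\<close> with the same indicator \<open>a\<close> must equal \<open>?C\<close>,
    which is minimality.\<close>
  have indicator: "(\<chi> i. if i \<in> D then 1 else 0) = a" if "vertex_cover G D" "D \<subseteq> ?C" for D
    by (rule irreducible_cover_minimal[OF irr b_cover_indicator[OF that(1)]]) (use that(2) in auto)
  have "D = ?C" if D: "vertex_cover G D" "D \<subseteq> ?C" for D
    unfolding indicator[OF D, symmetric] by auto
  then have "?C \<in> minimal_vertex_covers G"
    using C unfolding minimal_vertex_covers_def by blast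
  moreover have "a = (\<Sum>i\<in>?C. axis i 1)"
    unfolding sum_axis_one using indicator[OF C] by simp
  ultimately show "\<exists>C\<in>minimal_vertex_covers G. a = (\<Sum>i\<in>C. axis i 1)" by blast
next
  assume "\<exists>C\<in>minimal_vertex_covers G. a = (\<Sum>i\<in>C. axis i 1)"
  then obtain C where C: "C \<in> minimal_vertex_covers G"
    and a: "a = (\<chi> i. if i \<in> C then 1 else 0)"
    unfolding sum_axis_one by blast
  show "irreducible_cover G 1 a"
  proof (rule irreducible_coverI)
    show "b_cover G 1 a"
      unfolding a using C by (intro b_cover_indicator) (simp add: minimal_vertex_covers_def)
    fix c d
    assume d: "b_cover G 1 d" and eq: "a = c + d"
    have sum: "c $ j + d $ j = (if j \<in> C then 1 else 0)" for j
      using arg_cong[OF eq, of "\<lambda>x. x $ j"] by (simp add: a)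
    \<comment> \<open>The support of \<open>d\<close> is a vertex cover inside \<open>C\<close>,
      hence all of \<open>C\<close> by minimality, so \<open>d\<close> already exhausts the
      indicator.\<close>
    have "j \<in> C" if "d $ j \<noteq> 0" for j
      using sum[of j] that by (cases "j \<in> C") auto
    then have "{j. d $ j \<noteq> 0} \<subseteq> C" by blast
    then have "{j. d $ j \<noteq> 0} = C"
      using vertex_cover_support[OF d] C unfolding minimal_vertex_covers_def by blast
    then have "d $ j \<noteq> 0" if "j \<in> C" for j
      using that by blast
    then have "c $ j = 0" for j
      using sum[of j] by (cases "j \<in> C") (force split: if_splits)+
    then show "c = 0" by (simp add: vec_eq_iff)
  qed simp
qed

section \<open>The bound \<open>b \<le> 2\<close> for irreducible covers\<close>

lemma b_cover_split_2:
  fixes a :: "nat ^ 'v" and b :: nat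
  defines "c \<equiv> \<chi> i. if a $ i = 0 then 0 else if b \<le> a $ i then 2 else (1 :: nat)"
  assumes a: "b_cover G b a" and "2 \<le> b"
  shows "b_cover G 2 c"
    and "c $ i \<le> a $ i"
    and "{u, v} \<in> edges G \<Longrightarrow> b - 2 \<le> (a $ u - c $ u) + (a $ v - c $ v)"
proof -
  show "b_cover G 2 c"
  proof (rule b_coverI)
    fix i j
    assume "{i, j} \<in> edges G"
    \<comment> \<open>If one end has value 0, the other has at least \<open>b\<close> and gets 2;
      otherwise both get at least 1.\<close>
    then show "2 \<le> c $ i + c $ j"
      using b_coverD[OF a, of i j] \<open>2 \<le> b\<close> by (auto simp: c_def)
  qed simp
  show "c $ i \<le> a $ i"
    using \<open>2 \<le> b\<close> by (simp add: c_def)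
  \<comment> \<open>An end of value at least \<open>b\<close> keeps \<open>b - 2\<close> by itself.
    If there is none, neither end is 0, so each loses exactly 1.\<close>
  show "b - 2 \<le> (a $ u - c $ u) + (a $ v - c $ v)" if "{u, v} \<in> edges G"
    using b_coverD[OF a that] \<open>2 \<le> b\<close> by (auto simp: c_def)
qed

text \<open>For \<open>b > 2\<close> what is left after the splitting has positive weight
  \<open>b - 2\<close>, hence is nonzero and a genuine cover. For \<open>b = 2\<close> it may be the
  zero vector, so the argument stops there.\<close>

lemma irreducible_cover_le_2:
  assumes "irreducible_cover G b a"
  shows "b \<le> 2"
proof (rule ccontr)
  assume "\<not> b \<le> 2"
  then have b: "2 \<le> b" "0 < b - 2" by simp_all
  have a: "b_cover G b a" using assms by (simp add: irreducible_cover_def)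
  let ?c = "\<chi> i. if a $ i = 0 then 0 else if b \<le> a $ i then 2 else (1 :: nat)"
  note c = b_cover_split_2[OF a b(1)]
  have "b_cover G (b - 2) (\<chi> i. a $ i - ?c $ i)"
    by (rule b_coverI) (use b(2) c(3) in auto)
  then have "reducible_cover G b a"
    by (rule reducible_coverI[OF c(1)]) (use c(2) b in \<open>simp_all add: vec_eq_iff\<close>)
  then show False using assms by (simp add: irreducible_cover_def)
qed

section \<open>2-covers determined by an independent zero set\<close>

definition cover_of :: "'v set \<Rightarrow> nat ^ 'v" where
  "cover_of A = (\<chi> i. if i \<in> A then 0 else if i \<in> neighbour_set G A then 2 else 1)"

abbreviation rest :: "'v set \<Rightarrow> 'v ugraph" where
  "rest A \<equiv> induced_subgraph G (verts G - (A \<union> neighbour_set G A))"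

lemma cover_of_nth [simp]:
  "cover_of A $ i = (if i \<in> A then 0 else if i \<in> neighbour_set G A then 2 else 1)"
  by (simp add: cover_of_def)

lemma mem_neighbour_set: "v \<in> neighbour_set G A \<longleftrightarrow> (\<exists>u\<in>A. {u, v} \<in> edges G)"
  by (simp add: neighbour_set_def verts)

lemma neighbour_setI1: "{u, v} \<in> edges G \<Longrightarrow> u \<in> A \<Longrightarrow> v \<in> neighbour_set G A"
  and neighbour_setI2: "{u, v} \<in> edges G \<Longrightarrow> v \<in> A \<Longrightarrow> u \<in> neighbour_set G A"
  by (auto simp: mem_neighbour_set insert_commute)

lemma independent_disjoint_neighbour_set:
  "independent_set G A \<Longrightarrow> v \<in> A \<Longrightarrow> v \<notin> neighbour_set G A"
  by (auto simp: mem_neighbour_set independent_set_def)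

lemma verts_rest: "verts (rest A) = UNIV - (A \<union> neighbour_set G A)"
  by (auto simp: induced_subgraph_def verts)

lemma edge_rest_iff:
  "{u, v} \<in> edges (rest A) \<longleftrightarrow>
     {u, v} \<in> edges G \<and> u \<notin> A \<union> neighbour_set G A \<and> v \<notin> A \<union> neighbour_set G A"
  by (auto simp: induced_subgraph_def verts)

lemma b_cover_cover_of:
  assumes "independent_set G A"
  shows "b_cover G 2 (cover_of A)"
proof (rule b_coverI)
  fix i j
  assume e: "{i, j} \<in> edges G"
  show "2 \<le> cover_of A $ i + cover_of A $ j"
    using neighbour_setI1[OF e] neighbour_setI2[OF e] independent_disjoint_neighbour_set[OF assms]
    by auto
qed simp

text \<open>Two vertices of value 0 cannot be adjacent, and a neighbour of such a vertex has value
  at least 2. Thus \<open>cover_of ?A\<close> is the least 2-cover with zero set \<open>?A\<close>,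
  and minimality forces equality.\<close>

lemma irreducible_2_cover_eq_cover_of:
  assumes irr: "irreducible_cover G 2 a"
  shows "independent_set G {i. a $ i = 0}" "a = cover_of {i. a $ i = 0}"
proof -
  let ?A = "{i. a $ i = 0}"
  have a: "b_cover G 2 a" using irr by (simp add: irreducible_cover_def)
  show ind: "independent_set G ?A"
    using b_coverD[OF a] by (fastforce simp: independent_set_def verts)
  have le: "cover_of ?A $ i \<le> a $ i" for i
    using b_coverD[OF a] by (fastforce simp: mem_neighbour_set)
  show "a = cover_of ?A"
    using irreducible_cover_minimal[OF irr b_cover_cover_of[OF ind] le] by simp
qed

text \<open>All neighbours of a vertex \<open>v\<close> isolated in \<open>rest A\<close> lie in
  \<open>neighbour_set G A\<close> and have value 2, so the value 1 at \<open>v\<close> could be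
  lowered to 0, against minimality.\<close>

lemma no_isolated_rest:
  assumes ind: "independent_set G A" and irr: "irreducible_cover G 2 (cover_of A)"
  shows "no_isolated_vertices (rest A)"
proof (rule ccontr)
  assume "\<not> no_isolated_vertices (rest A)"
  then obtain v where v: "v \<notin> A" "v \<notin> neighbour_set G A" "\<And>u. {u, v} \<notin> edges (rest A)"
    by (auto simp: no_isolated_vertices_def verts_rest)
  have nb: "u \<in> neighbour_set G A \<and> u \<notin> A" if "{u, v} \<in> edges G" for u
    using that v neighbour_setI1[OF that] by (auto simp: edge_rest_iff)
  let ?d = "\<chi> i. if i = v then 0 else cover_of A $ i"
  have "b_cover G 2 ?d"
  proof (rule b_coverI)
    fix i j
    assume e: "{i, j} \<in> edges G"
    consider "i = v" | "j = v" | "i \<noteq> v" "j \<noteq> v" by blast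
    then show "2 \<le> ?d $ i + ?d $ j"
    proof cases
      case 1
      then show ?thesis using nb[of j] e not_loop by (auto simp: insert_commute)
    next
      case 2
      then show ?thesis using nb[of i] e not_loop by auto
    next
      case 3
      then show ?thesis using b_coverD[OF b_cover_cover_of[OF ind] e] by simp
    qed
  qed simp
  then have "?d = cover_of A"
    by (rule irreducible_cover_minimal[OF irr]) simp
  then have "?d $ v = cover_of A $ v" by simp
  then show False using v by simp
qed

lemma reducible_if_bipartite_rest:
  assumes ind: "independent_set G A" and "bipartite (rest A)"
  shows "reducible_cover G 2 (cover_of A)"
proof -
  obtain X Y where XY: "X \<union> Y = verts (rest A)" "X \<inter> Y = {}"
    and e: "\<forall>e\<in>edges (rest A). \<exists>x\<in>X. \<exists>y\<in>Y. e = {x, y}"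
    using assms(2) by (rule bipartiteE)
  \<comment> \<open>An edge that misses \<open>neighbour_set G A\<close> has no end in
    \<open>A\<close> either, so it belongs to \<open>rest A\<close> and only such edges have to be
    met by \<open>Z\<close>.\<close>
  have cover: "vertex_cover G (neighbour_set G A \<union> Z)"
    if Z: "\<And>e. e \<in> edges (rest A) \<Longrightarrow> e \<inter> Z \<noteq> {}" for Z
    unfolding vertex_cover_def
  proof (intro conjI ballI)
    fix e
    assume "e \<in> edges G"
    then obtain u v where uv: "e = {u, v}" by (rule edgeE)
    then have uv': "{u, v} \<in> edges G" using \<open>e \<in> edges G\<close> by simp
    show "e \<inter> (neighbour_set G A \<union> Z) \<noteq> {}"
      using neighbour_setI1[OF uv', of A] neighbour_setI2[OF uv', of A] uv' Z[of e] edge_rest_iff[of u v A]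
      unfolding uv by blast
  qed (simp add: verts)
  have "f \<inter> X \<noteq> {}" "f \<inter> Y \<noteq> {}" if "f \<in> edges (rest A)" for f
    using bspec[OF e that] by auto
  then have X: "vertex_cover G (neighbour_set G A \<union> X)" and Y: "vertex_cover G (neighbour_set G A \<union> Y)"
    using cover by blast+
  show ?thesis
  proof (rule reducible_coverI[OF b_cover_indicator[OF X] b_cover_indicator[OF Y]])
    \<comment> \<open>Vertices of \<open>neighbour_set G A\<close> are counted twice, those of the
      rest once, in their own colour class, and those of \<open>A\<close> never, by
      independence.\<close>
    have "cover_of A $ i = (if i \<in> neighbour_set G A \<union> X then 1 else 0)
        + (if i \<in> neighbour_set G A \<union> Y then 1 else 0)" for i
      using XY independent_disjoint_neighbour_set[OF ind, of i] unfolding verts_rest by auto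
    then show "cover_of A = (\<chi> i. if i \<in> neighbour_set G A \<union> X then 1 else 0)
        + (\<chi> i. if i \<in> neighbour_set G A \<union> Y then 1 else 0)"
      by (simp only: vec_eq_iff vector_add_component vec_lambda_beta) simp
  qed simp
qed

lemma irreducible_if_not_bipartite_rest:
  assumes ind: "independent_set G A" and iso: "no_isolated_vertices (rest A)"
    and bip: "\<not> bipartite (rest A)"
  shows "irreducible_cover G 2 (cover_of A)"
proof (rule irreducible_coverI[OF b_cover_cover_of[OF ind]])
  fix c d
  assume d: "b_cover G 2 d" and eq: "cover_of A = c + d"
  have sum: "c $ j + d $ j = cover_of A $ j" for j
    by (simp add: eq)
  \<comment> \<open>The 2-cover \<open>d\<close> needs all of \<open>cover_of A\<close>: a vertex of
    \<open>neighbour_set G A\<close> has a neighbour of value 0 and needs 2, and a vertex of the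
    rest has a neighbour of value 1 and needs 1.\<close>
  have "c $ j = 0" for j
  proof -
    consider "j \<in> A" | "j \<notin> A" "j \<in> neighbour_set G A" | "j \<in> verts (rest A)"
      by (auto simp: verts_rest)
    then show ?thesis
    proof cases
      case 1
      then show ?thesis using sum[of j] by simp
    next
      case 2
      then obtain u where u: "u \<in> A" "{u, j} \<in> edges G" by (auto simp: mem_neighbour_set)
      show ?thesis using b_coverD[OF d u(2)] sum[of u] sum[of j] u(1) 2 by simp
    next
      case 3
      then obtain u where u: "{u, j} \<in> edges (rest A)"
        using iso by (auto simp: no_isolated_vertices_def)
      then have "{u, j} \<in> edges G" by (simp add: edge_rest_iff)
      from b_coverD[OF d this] show ?thesis
        using sum[of u] sum[of j] u by (simp add: edge_rest_iff)
    qed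
  qed
  then show "c = 0" by (simp add: vec_eq_iff)
next
  fix i j c d
  assume ij: "0 < i" "0 < j" "(2 :: nat) = i + j" and c: "b_cover G i c" and d: "b_cover G j d"
  then have "i = 1" "j = 1" by simp_all
  show "cover_of A \<noteq> c + d"
  proof
    assume eq: "cover_of A = c + d"
    have sum: "c $ k + d $ k = cover_of A $ k" for k
      by (simp add: eq)
    \<comment> \<open>The rest is coloured by whether \<open>c\<close> vanishes. There
      \<open>c\<close> and \<open>d\<close> add up to 1, and both are 1-covers, so on each edge
      \<open>c\<close> vanishes at exactly one end.\<close>
    have edge: "\<exists>x\<in>{k \<in> verts (rest A). c $ k = 0}. \<exists>y\<in>{k \<in> verts (rest A). c $ k \<noteq> 0}. e = {x, y}"
      if "e \<in> edges (rest A)" for e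
    proof -
      have "e \<in> edges G" using that by (simp add: induced_subgraph_def)
      then obtain u v where uv: "e = {u, v}" by (rule edgeE)
      have r: "u \<in> verts (rest A)" "v \<in> verts (rest A)"
        using that by (auto simp: uv edge_rest_iff verts_rest)
      have s: "c $ u + d $ u = 1" "c $ v + d $ v = 1"
        using sum[of u] sum[of v] r by (simp_all add: verts_rest)
      have "1 \<le> c $ u + c $ v" "1 \<le> d $ u + d $ v"
        using b_coverD[OF c] b_coverD[OF d] \<open>e \<in> edges G\<close> \<open>i = 1\<close> \<open>j = 1\<close> by (auto simp: uv)
      then have "(c $ u = 0 \<and> c $ v \<noteq> 0) \<or> (c $ v = 0 \<and> c $ u \<noteq> 0)"
        using s by linarith
      then show ?thesis using r by (auto simp: uv)
    qed
    have "bipartite (rest A)"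
      unfolding bipartite_def
      by (rule exI[of _ "{k \<in> verts (rest A). c $ k = 0}"],
          rule exI[of _ "{k \<in> verts (rest A). c $ k \<noteq> 0}"]) (use edge in auto)
    then show False using bip by simp
  qed
qed

section \<open>Classification of the irreducible covers\<close>

lemma irreducible_2_cover_iff:
  "irreducible_cover G 2 a \<longleftrightarrow>
     (\<exists>A. independent_set G A \<and> a = cover_of A \<and>
        no_isolated_vertices (rest A) \<and> \<not> bipartite (rest A))"
proof
  assume irr: "irreducible_cover G 2 a"
  \<comment> \<open>The only candidate for \<open>A\<close>, since \<open>cover_of A\<close>
    vanishes exactly on \<open>A\<close>.\<close>
  let ?A = "{i. a $ i = 0}"
  note A = irreducible_2_cover_eq_cover_of[OF irr]
  have irr': "irreducible_cover G 2 (cover_of ?A)" using irr A(2) by simp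
  then have "\<not> bipartite (rest ?A)"
    using reducible_if_bipartite_rest[OF A(1)] by (auto simp: irreducible_cover_def)
  then show "\<exists>A. independent_set G A \<and> a = cover_of A \<and>
        no_isolated_vertices (rest A) \<and> \<not> bipartite (rest A)"
    using A no_isolated_rest[OF A(1) irr'] by blast
qed (auto intro: irreducible_if_not_bipartite_rest)

text \<open>Lets the all-ones vector be treated as the case \<open>A = {}\<close>, with the
  hypotheses on \<open>G\<close> itself serving as those on the rest.\<close>

lemma rest_empty: "rest {} = G"
  using simple
  by (cases G) (auto simp: induced_subgraph_def neighbour_set_def finite_simple_graph_def)

text \<open>A non-bipartite rest has an edge. That edge avoids \<open>A\<close> and
  \<open>neighbour_set G A\<close>, so it is not covered and its ends are further vertices.\<close>

lemma not_vertex_cover_if_not_bipartite_rest: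
  assumes "\<not> bipartite (rest A)"
  shows "\<not> vertex_cover G (neighbour_set G A)" "verts G \<noteq> A \<union> neighbour_set G A"
proof -
  obtain e where e: "e \<in> edges (rest A)" using assms bipartite_edgeless by blast
  then have "e \<in> edges G" "e \<inter> (A \<union> neighbour_set G A) = {}"
    by (auto simp: induced_subgraph_def)
  moreover from this(1) have "e \<subseteq> verts G" "e \<noteq> {}"
    using simple by (auto simp: finite_simple_graph_def)
  ultimately show "\<not> vertex_cover G (neighbour_set G A)" "verts G \<noteq> A \<union> neighbour_set G A"
    unfolding vertex_cover_def by blast+
qed

lemma irreducible_cover_iff:
  "irreducible_cover G b a \<longleftrightarrow>
     b = 0 \<and> (\<exists>i. a = axis i 1) \<or>
     b = 1 \<and> (\<exists>C\<in>minimal_vertex_covers G. a = (\<Sum>i\<in>C. axis i 1)) \<or>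
     b = 2 \<and> (\<exists>A. independent_set G A \<and> a = cover_of A \<and>
       no_isolated_vertices (rest A) \<and> \<not> bipartite (rest A))"
proof -
  have "b = 0 \<or> b = 1 \<or> b = 2" if "irreducible_cover G b a"
    using irreducible_cover_le_2[OF that] by linarith
  then show ?thesis
    using irreducible_0_cover_iff irreducible_1_cover_iff irreducible_2_cover_iff by auto
qed

lemma irreducible_2_cover_cases:
  assumes "\<not> bipartite G"
  shows "(\<exists>A. independent_set G A \<and> a = cover_of A \<and>
       no_isolated_vertices (rest A) \<and> \<not> bipartite (rest A)) \<longleftrightarrow>
     a = (\<chi> i. 1) \<or>
     (\<exists>A. A \<noteq> {} \<and> independent_set G A \<and> a = cover_of A \<and>
       \<not> vertex_cover G (neighbour_set G A) \<and> verts G \<noteq> A \<union> neighbour_set G A \<and>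
       no_isolated_vertices (rest A) \<and> \<not> bipartite (rest A))"
    (is "?L \<longleftrightarrow> ?R")
proof -
  have empty: "cover_of {} = (\<chi> i. 1)"
    by (simp add: vec_eq_iff mem_neighbour_set)
  have "independent_set G {}" by (simp add: independent_set_def)
  moreover have "no_isolated_vertices (rest {})" "\<not> bipartite (rest {})"
    using assms no_isolated by (simp_all only: rest_empty not_False_eq_True)
  ultimately have "?L" if "a = (\<chi> i. 1)"
    using that empty by metis
  moreover have "?R" if "?L"
    using that empty not_vertex_cover_if_not_bipartite_rest by metis
  ultimately show ?thesis by blast
qed

end

theorem theorem5p1p9:
  fixes G :: "'v::finite ugraph" and a :: "nat ^ 'v" and b :: nat
  assumes "finite_simple_graph G"
    and "verts G = UNIV"
    and "no_isolated_vertices G"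
    and "a \<noteq> 0"
  shows
    "(bipartite G \<longrightarrow>
       (irreducible_cover G b a \<longleftrightarrow>
          (b = 0 \<and> (\<exists>i. a = axis i 1)) \<or>
          (b = 1 \<and> (\<exists>C\<in>minimal_vertex_covers G. a = (\<Sum>i\<in>C. axis i 1)))))
     \<and>
     (\<not> bipartite G \<longrightarrow>
       (irreducible_cover G b a \<longleftrightarrow>
          (b = 0 \<and> (\<exists>i. a = axis i 1)) \<or>
          (b = 1 \<and> (\<exists>C\<in>minimal_vertex_covers G. a = (\<Sum>i\<in>C. axis i 1))) \<or>
          (b = 2 \<and> a = (\<chi> i. 1)) \<or>
          (b = 2 \<and>
            (\<exists>A. A \<noteq> {} \<and> independent_set G A \<and>
               a = (\<chi> i. if i \<in> A then 0 else if i \<in> neighbour_set G A then 2 else 1) \<and>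
               \<not> vertex_cover G (neighbour_set G A) \<and>
               verts G \<noteq> A \<union> neighbour_set G A \<and>
               no_isolated_vertices
                 (induced_subgraph G (verts G - (A \<union> neighbour_set G A))) \<and>
               \<not> bipartite
                 (induced_subgraph G (verts G - (A \<union> neighbour_set G A)))))))"
proof -
  note G = assms(1-3)
  note iff = irreducible_cover_iff[OF G, of b a]
  show ?thesis
  proof (intro conjI impI)
    \<comment> \<open>Every induced subgraph is bipartite as well, so no set \<open>A\<close>
      qualifies and the case \<open>b = 2\<close> is empty.\<close>
    assume "bipartite G"
    then show "irreducible_cover G b a \<longleftrightarrow>
          (b = 0 \<and> (\<exists>i. a = axis i 1)) \<or>
          (b = 1 \<and> (\<exists>C\<in>minimal_vertex_covers G. a = (\<Sum>i\<in>C. axis i 1)))"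
      using iff bipartite_induced_subgraph by blast
  next
    assume "\<not> bipartite G"
    from iff[unfolded irreducible_2_cover_cases[OF G this], unfolded cover_of_def[OF G]]
    show "irreducible_cover G b a \<longleftrightarrow>
          (b = 0 \<and> (\<exists>i. a = axis i 1)) \<or>
          (b = 1 \<and> (\<exists>C\<in>minimal_vertex_covers G. a = (\<Sum>i\<in>C. axis i 1))) \<or>
          (b = 2 \<and> a = (\<chi> i. 1)) \<or>
          (b = 2 \<and>
            (\<exists>A. A \<noteq> {} \<and> independent_set G A \<and>
               a = (\<chi> i. if i \<in> A then 0 else if i \<in> neighbour_set G A then 2 else 1) \<and>
               \<not> vertex_cover G (neighbour_set G A) \<and>
               verts G \<noteq> A \<union> neighbour_set G A \<and>
               no_isolated_vertices
                 (induced_subgraph G (verts G - (A \<union> neighbour_set G A))) \<and>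
               \<not> bipartite
                 (induced_subgraph G (verts G - (A \<union> neighbour_set G A)))))"
      by (simp only: conj_disj_distribL disj_assoc)
  qed
qed

end
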